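(* (a) regWRTI is equivalent to RD if and only if regWRTI is p-natural. (b) regWRTL is equivalent to RD if and only if regWRTL is p-natural.
   Context: Clauses are finite sets of literals; $\Box$ the empty clause. Resolution: from $C_0\ni x$, $C_1\ni\overline x$ infer $(C_0\setminus\{x\})\cup(C_1\setminus\{\overline x\})$; w-resolution: the same inference from arbitrary $C_0,C_1$ and a variable $x$. An RD refutation of $F$: a finite dag of clause-labeled nodes with a unique out-degree-0 node labeled $\Box$, in-degree-0 nodes labeled by clauses of $F$, other nodes of in-degree 2 labeled by a variable and the resolvent on it of the predecessors' clauses. A regWRTL refutation of $F$: an ordered binary tree $T$ with post-order $<_T$ (left subtree, right subtree, node) where each leaf $v$ is labeled by a clause of $F$ or by a clause labeling some node $u<_T v$, each internal node by a variable $x$ and the w-resolvent on $x$ of its children's clauses, the root by $\Box$, and no leaf-to-root path contains two inferences on the same variable. A regWRTI refutation is a regWRTL refutation in which each leaf $v$ not labeled from $F$ is labeled by the clause of some input-derived node $u<_T v$, where a node is input-derived if its subtree is an input resolution tree (only genuine resolution, every internal node having a leaf child). Size = number of nodes. An assignment (restriction) $\alpha$ is a partial map from variables to $\{0,1\}$. $C|_\alpha=1$ if some literal of $C$ is true under $\alpha$, $0$ if all are false, otherwise the set of unassigned literals of $C$; $F|_\alpha=0$ if some $C|_\alpha=0$, $1$ if all $C|_\alpha=1$, otherwise $\{C|_\alpha: C\in F\}\setminus\{1\}$. A refutation system $\mathcal R$ is p-natural if there is a polynomial $p$ such that whenever $F$ has an $\mathcal R$-refutation of size $s$ and $\alpha$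 is a restriction, $F|_\alpha$ has an $\mathcal R$-refutation of size $\le p(s)$. Systems $Q,R$ are equivalent if each simulates the other, where $Q$ simulates $R$ if there is a polynomial $p$ such that every $F$ with an $R$-refutation of size $n$ has a $Q$-refutation of size $\le p(n)$. *)

theory Defs
  imports "HOL-Library.Infinite_Typeclass" "HOL-Computational_Algebra.Polynomial"
begin

subsection \<open>Clauses, resolution and w-resolution\<close>

datatype 'v literal = Pos 'v | Neg 'v

type_synonym 'v clause = "'v literal set"

definition cnf :: "'v clause set \<Rightarrow> bool" where
  "cnf F \<longleftrightarrow> finite F \<and> (\<forall>C\<in>F. finite C)"

definition w_res :: "'v \<Rightarrow> 'v clause \<Rightarrow> 'v clause \<Rightarrow> 'v clause" where
  "w_res x C\<^sub>0 C\<^sub>1 = (C\<^sub>0 - {Pos x}) \<union> (C\<^sub>1 - {Neg x})"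

text \<open>Both predicates are symmetric in the two premises \<open>A\<close> and \<open>B\<close>: either of them may be the
  premise from which the positive literal is removed.\<close>

definition is_w_resolvent :: "'v \<Rightarrow> 'v clause \<Rightarrow> 'v clause \<Rightarrow> 'v clause \<Rightarrow> bool" where
  "is_w_resolvent x A B C \<longleftrightarrow> C = w_res x A B \<or> C = w_res x B A"

definition is_resolvent :: "'v \<Rightarrow> 'v clause \<Rightarrow> 'v clause \<Rightarrow> 'v clause \<Rightarrow> bool" where
  "is_resolvent x A B C \<longleftrightarrow>
     (Pos x \<in> A \<and> Neg x \<in> B \<and> C = w_res x A B) \<or>
     (Pos x \<in> B \<and> Neg x \<in> A \<and> C = w_res x B A)"

subsection \<open>Refutation systems\<close>

text \<open>A refutation system \<open>R\<close> enters only through the relation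
  ``\<open>R F n\<close>: the formula \<open>F\<close> has an \<open>R\<close>-refutation of size \<open>n\<close>''.\<close>

type_synonym 'v refutation_system = "'v clause set \<Rightarrow> nat \<Rightarrow> bool"

subsubsection \<open>Resolution dags\<close>

definition rd_refutation ::
  "'v clause set \<Rightarrow> nat set \<Rightarrow> (nat \<times> nat) set \<Rightarrow> (nat \<Rightarrow> 'v clause) \<Rightarrow> (nat \<Rightarrow> 'v) \<Rightarrow> bool" where
  "rd_refutation F V E cls var \<longleftrightarrow>
     finite V \<and> E \<subseteq> V \<times> V \<and> acyclic E \<and>
     (\<exists>!v. v \<in> V \<and> E `` {v} = {}) \<and>
     (\<forall>v\<in>V. E `` {v} = {} \<longrightarrow> cls v = {}) \<and>
     (\<forall>v\<in>V. E\<inverse> `` {v} = {} \<longrightarrow> cls v \<in> F) \<and>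
     (\<forall>v\<in>V. E\<inverse> `` {v} \<noteq> {} \<longrightarrow>
        (\<exists>u w. u \<noteq> w \<and> E\<inverse> `` {v} = {u, w} \<and> is_resolvent (var v) (cls u) (cls w) (cls v)))"

definition RD :: "'v refutation_system" where
  "RD F n \<longleftrightarrow> (\<exists>V E cls var. rd_refutation F V E cls var \<and> card V = n)"

subsubsection \<open>Resolution trees with lemmas\<close>

datatype 'v rtree =
    Leaf "'v clause"
  | Infer "'v rtree" 'v "'v clause" "'v rtree"

fun label :: "'v rtree \<Rightarrow> 'v clause" where
  "label (Leaf C) = C"
| "label (Infer l x C r) = C"

fun is_leaf :: "'v rtree \<Rightarrow> bool" where
  "is_leaf (Leaf C) = True"
| "is_leaf (Infer l x C r) = False"

text \<open>A node of \<open>T\<close> is represented by its position in \<open>postorder T\<close>, where the list entry is the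
  subtree rooted at that node. Hence \<open>u\<close> precedes \<open>v\<close> in post-order iff its position is smaller.\<close>

fun postorder :: "'v rtree \<Rightarrow> 'v rtree list" where
  "postorder (Leaf C) = [Leaf C]"
| "postorder (Infer l x C r) = postorder l @ postorder r @ [Infer l x C r]"

definition tree_size :: "'v rtree \<Rightarrow> nat" where
  "tree_size T = length (postorder T)"

text \<open>The sequences of inference variables along the leaf-to-root paths.\<close>

fun path_vars :: "'v rtree \<Rightarrow> 'v list set" where
  "path_vars (Leaf C) = {[]}"
| "path_vars (Infer l x C r) = (\<lambda>p. p @ [x]) ` (path_vars l \<union> path_vars r)"

definition regular :: "'v rtree \<Rightarrow> bool" where
  "regular T \<longleftrightarrow> (\<forall>p\<in>path_vars T. distinct p)"

definition regWRTL_refutation :: "'v clause set \<Rightarrow> 'v rtree \<Rightarrow> bool" where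
  "regWRTL_refutation F T \<longleftrightarrow>
     (\<forall>v < length (postorder T). \<forall>C. postorder T ! v = Leaf C \<longrightarrow>
        C \<in> F \<or> (\<exists>u < v. label (postorder T ! u) = C)) \<and>
     (\<forall>l x C r. Infer l x C r \<in> set (postorder T) \<longrightarrow> is_w_resolvent x (label l) (label r) C) \<and>
     label T = {} \<and>
     regular T"

definition input_tree :: "'v rtree \<Rightarrow> bool" where
  "input_tree T \<longleftrightarrow>
     (\<forall>l x C r. Infer l x C r \<in> set (postorder T) \<longrightarrow>
        is_resolvent x (label l) (label r) C \<and> (is_leaf l \<or> is_leaf r))"

definition regWRTI_refutation :: "'v clause set \<Rightarrow> 'v rtree \<Rightarrow> bool" where
  "regWRTI_refutation F T \<longleftrightarrow>
     regWRTL_refutation F T \<and>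
     (\<forall>v < length (postorder T). \<forall>C. postorder T ! v = Leaf C \<longrightarrow>
        C \<in> F \<or> (\<exists>u < v. input_tree (postorder T ! u) \<and> label (postorder T ! u) = C))"

definition regWRTL :: "'v refutation_system" where
  "regWRTL F n \<longleftrightarrow> (\<exists>T. regWRTL_refutation F T \<and> tree_size T = n)"

definition regWRTI :: "'v refutation_system" where
  "regWRTI F n \<longleftrightarrow> (\<exists>T. regWRTI_refutation F T \<and> tree_size T = n)"

subsection \<open>Restrictions\<close>

datatype 'a restricted = Zero | One | Rest 'a

fun lit_val :: "('v \<rightharpoonup> bool) \<Rightarrow> 'v literal \<Rightarrow> bool option" where
  "lit_val \<alpha> (Pos x) = \<alpha> x"
| "lit_val \<alpha> (Neg x) = map_option Not (\<alpha> x)"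

definition restrict_clause :: "('v \<rightharpoonup> bool) \<Rightarrow> 'v clause \<Rightarrow> 'v clause restricted" where
  "restrict_clause \<alpha> C =
     (if \<exists>l\<in>C. lit_val \<alpha> l = Some True then One
      else if \<forall>l\<in>C. lit_val \<alpha> l = Some False then Zero
      else Rest {l \<in> C. lit_val \<alpha> l = None})"

definition restrict_cnf :: "('v \<rightharpoonup> bool) \<Rightarrow> 'v clause set \<Rightarrow> 'v clause set restricted" where
  "restrict_cnf \<alpha> F =
     (if \<exists>C\<in>F. restrict_clause \<alpha> C = Zero then Zero
      else if \<forall>C\<in>F. restrict_clause \<alpha> C = One then One
      else Rest {D. \<exists>C\<in>F. restrict_clause \<alpha> C = Rest D})"

text \<open>To speak about refutations of a restricted formula, the constant 0 is read as the formula
  consisting of the empty clause and the constant 1 as the empty set of clauses.\<close>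

fun cnf_of :: "'v clause set restricted \<Rightarrow> 'v clause set" where
  "cnf_of Zero = {{}}"
| "cnf_of One = {}"
| "cnf_of (Rest F) = F"

subsection \<open>Simulation and p-naturality\<close>

text \<open>Polynomial bounds are taken with natural coefficients; any other polynomial is dominated on
  the natural numbers by one of these.\<close>

definition simulates :: "'v refutation_system \<Rightarrow> 'v refutation_system \<Rightarrow> bool" where
  "simulates Q R \<longleftrightarrow>
     (\<exists>p :: nat poly. \<forall>F n. cnf F \<longrightarrow> R F n \<longrightarrow> (\<exists>m \<le> poly p n. Q F m))"

definition equivalent :: "'v refutation_system \<Rightarrow> 'v refutation_system \<Rightarrow> bool" where
  "equivalent Q R \<longleftrightarrow> simulates Q R \<and> simulates R Q"

definition p_natural :: "'v refutation_system \<Rightarrow> bool" where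
  "p_natural R \<longleftrightarrow>
     (\<exists>p :: nat poly. \<forall>F s \<alpha>. cnf F \<longrightarrow> R F s \<longrightarrow>
        (\<exists>m \<le> poly p s. R (cnf_of (restrict_cnf \<alpha> F)) m))"

end

theory Submission imports Defs begin

text \<open>RD simulates both tree systems, because the labels in post-order form a derivation with
  weakening from which weakenings and tautologies can be eliminated, and RD is p-natural because such
  derivations are closed under restrictions. Hence equivalence with RD implies p-naturality.

  Conversely, given an RD refutation of \<open>F\<close> resolving on the variables \<open>X\<close>, extend \<open>F\<close> by clauses that
  all contain a fresh literal \<open>q\<close>, namely \<open>{q}\<close> and \<open>{q, l}\<close> for the literals \<open>l\<close> over \<open>X\<close>. Each
  clause of the refutation is learned by a single resolution of two leaves and then reduced to \<open>{q}\<close>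
  by resolving away its literals, without repeating a variable. These pieces are chained by
  w-resolutions on fresh variables, and a final w-resolution on \<open>q\<close> with the lemma \<open>{}\<close> gives a
  regWRTI refutation of the extension. Setting \<open>q\<close> to true restricts the extension to \<open>F\<close>, so
  p-naturality transfers the refutation to \<open>F\<close>.\<close>

section \<open>Literals and tautological clauses\<close>

fun var_of :: "'v literal \<Rightarrow> 'v" where
  "var_of (Pos x) = x"
| "var_of (Neg x) = x"

fun negate :: "'v literal \<Rightarrow> 'v literal" where
  "negate (Pos x) = Neg x"
| "negate (Neg x) = Pos x"

definition tautological :: "'v clause \<Rightarrow> bool" where
  "tautological C \<longleftrightarrow> (\<exists>x. Pos x \<in> C \<and> Neg x \<in> C)"

section \<open>Derivations as lists of clauses\<close>

text \<open>The newest clause stands at the head, so premises lie in the tail. Every rule may add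
  literals, which keeps this form stable under restrictions and lets it express w-resolution.
  \<open>X\<close> confines only the resolved variables.\<close>

inductive weak_derivation :: "'v clause set \<Rightarrow> 'v set \<Rightarrow> 'v clause list \<Rightarrow> bool"
  for F :: "'v clause set" and X :: "'v set" where
  Nil: "weak_derivation F X []"
| axiom: "weak_derivation F X Cs \<Longrightarrow> A \<in> F \<Longrightarrow> A \<subseteq> C \<Longrightarrow> weak_derivation F X (C # Cs)"
| weaken: "weak_derivation F X Cs \<Longrightarrow> A \<in> set Cs \<Longrightarrow> A \<subseteq> C \<Longrightarrow> weak_derivation F X (C # Cs)"
| resolve: "weak_derivation F X Cs \<Longrightarrow> A \<in> set Cs \<Longrightarrow> B \<in> set Cs \<Longrightarrow> x \<in> X \<Longrightarrow>
    w_res x A B \<subseteq> C \<Longrightarrow> weak_derivation F X (C # Cs)"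

text \<open>The strict form that dags and the tree construction rely on: genuine resolution between
  non-tautological clauses over \<open>X\<close>. For finite \<open>X\<close> such a clause has at
  most \<open>card X\<close> literals, on pairwise distinct variables.\<close>

inductive derivation :: "'v clause set \<Rightarrow> 'v set \<Rightarrow> 'v clause list \<Rightarrow> bool"
  for F :: "'v clause set" and X :: "'v set" where
  Nil: "derivation F X []"
| axiom: "derivation F X Ds \<Longrightarrow> C \<in> F \<Longrightarrow> \<not> tautological C \<Longrightarrow> var_of ` C \<subseteq> X \<Longrightarrow>
    derivation F X (C # Ds)"
| resolve: "derivation F X Ds \<Longrightarrow> A \<in> set Ds \<Longrightarrow> B \<in> set Ds \<Longrightarrow> Pos x \<in> A \<Longrightarrow> Neg x \<in> B \<Longrightarrow>
    \<not> tautological A \<Longrightarrow> \<not> tautological B \<Longrightarrow>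
    \<not> tautological (w_res x A B) \<Longrightarrow> x \<in> X \<Longrightarrow> var_of ` w_res x A B \<subseteq> X \<Longrightarrow>
    derivation F X (w_res x A B # Ds)"

lemma tautological_mono: "A \<subseteq> B \<Longrightarrow> tautological A \<Longrightarrow> tautological B"
  by (auto simp: tautological_def)

definition admissible :: "'v set \<Rightarrow> 'v clause \<Rightarrow> bool" where
  "admissible X C \<longleftrightarrow> \<not> tautological C \<and> var_of ` C \<subseteq> X"

lemma admissible_mono: "A \<subseteq> B \<Longrightarrow> admissible X B \<Longrightarrow> admissible X A"
  unfolding admissible_def using tautological_mono by blast

text \<open>A tautological premise can contribute to a non-tautological resolvent only through the
  resolved variable, and then the other premise already subsumes the resolvent.\<close>

lemma subsumed_premise:
  assumes "tautological A \<or> tautological B" "w_res x A B \<subseteq> C" "\<not> tautological C"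
  shows "(B \<subseteq> C \<and> tautological A) \<or> (A \<subseteq> C \<and> tautological B)"
  using assms(1)
proof
  assume A: "tautological A"
  then obtain y where y: "Pos y \<in> A" "Neg y \<in> A" unfolding tautological_def by blast
  then have "Neg y \<in> C" using assms(2) unfolding w_res_def by blast
  then have "Pos y \<notin> C" using assms(3) unfolding tautological_def by blast
  then have "y = x" using y(1) assms(2) unfolding w_res_def by blast
  then have "B \<subseteq> C" using \<open>Neg y \<in> C\<close> assms(2) unfolding w_res_def by blast
  then show ?thesis using A by blast
next
  assume B: "tautological B"
  then obtain y where y: "Pos y \<in> B" "Neg y \<in> B" unfolding tautological_def by blast
  then have "Pos y \<in> C" using assms(2) unfolding w_res_def by blast
  then have "Neg y \<notin> C" using assms(3) unfolding tautological_def by blast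
  then have "y = x" using y(2) assms(2) unfolding w_res_def by blast
  then have "A \<subseteq> C" using \<open>Pos y \<in> C\<close> assms(2) unfolding w_res_def by blast
  then show ?thesis using B by blast
qed

text \<open>Admissible clauses are replaced by subclauses. When no derived clause subsumes the
  conclusion of a w-resolution yet, both strengthened premises must contain their pivot literals, so
  the inference is a genuine resolution.\<close>

lemma derivation_of_weak_derivation:
  assumes "weak_derivation F X Cs"
  shows "\<exists>Ds. derivation F X Ds \<and> length Ds \<le> length Cs \<and>
    (\<forall>C\<in>set Cs. admissible X C \<longrightarrow> (\<exists>D\<in>set Ds. D \<subseteq> C))"
  using assms
proof induction
  case Nil
  then show ?case by (auto intro: derivation.Nil)
next
  case (axiom Cs A C)
  obtain Ds where Ds: "derivation F X Ds" "length Ds \<le> length Cs"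
    "\<forall>C\<in>set Cs. admissible X C \<longrightarrow> (\<exists>D\<in>set Ds. D \<subseteq> C)" using axiom.IH by blast
  show ?case
  proof (cases "admissible X C")
    case True
    then have "admissible X A" using admissible_mono axiom.hyps by blast
    then have "derivation F X (A # Ds)"
      using derivation.axiom[OF Ds(1) axiom.hyps(2)] unfolding admissible_def by blast
    then show ?thesis using Ds axiom.hyps by (intro exI[of _ "A # Ds"]) simp
  next
    case False
    then show ?thesis using Ds by (intro exI[of _ Ds]) simp
  qed
next
  case (weaken Cs A C)
  obtain Ds where Ds: "derivation F X Ds" "length Ds \<le> length Cs"
    "\<forall>C\<in>set Cs. admissible X C \<longrightarrow> (\<exists>D\<in>set Ds. D \<subseteq> C)" using weaken.IH by blast
  have "\<exists>D\<in>set Ds. D \<subseteq> C" if "admissible X C"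
  proof -
    have "admissible X A" using admissible_mono[OF weaken.hyps(3) that] .
    then obtain D where "D \<in> set Ds" "D \<subseteq> A" using Ds(3) weaken.hyps(2) by blast
    then show ?thesis using weaken.hyps(3) by (meson order_trans)
  qed
  then show ?case using Ds by (intro exI[of _ Ds]) simp
next
  case (resolve Cs A B x C)
  obtain Ds where Ds: "derivation F X Ds" "length Ds \<le> length Cs"
    "\<forall>C\<in>set Cs. admissible X C \<longrightarrow> (\<exists>D\<in>set Ds. D \<subseteq> C)" using resolve.IH by blast
  show ?case
  proof (cases "admissible X C \<and> \<not> (\<exists>D\<in>set Ds. D \<subseteq> C)")
    case False
    then show ?thesis using Ds by (intro exI[of _ Ds]) auto
  next
    case True
    then have C: "\<not> tautological C" "var_of ` C \<subseteq> X" and min: "\<And>D. D \<in> set Ds \<Longrightarrow> \<not> D \<subseteq> C"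
      by (auto simp: admissible_def)
    have sub: "A \<subseteq> insert (Pos x) C" "B \<subseteq> insert (Neg x) C"
      using resolve.hyps(5) by (auto simp: w_res_def)
    have "var_of ` insert (Pos x) C \<subseteq> X" "var_of ` insert (Neg x) C \<subseteq> X"
      using C resolve.hyps(4) by auto
    then have vars: "var_of ` A \<subseteq> X" "var_of ` B \<subseteq> X" using sub by blast+
    \<comment> \<open>Such a \<open>D\<close> would be admissible, and its subclause in
      \<open>Ds\<close> would already subsume \<open>C\<close>.\<close>
    have A: "\<not> D \<subseteq> C" if "D \<in> set Cs" for D
    proof
      assume "D \<subseteq> C"
      then have "admissible X D" using admissible_mono True by blast
      then show False using Ds(3) that min \<open>D \<subseteq> C\<close> by blast
    qed
    \<comment> \<open>A tautological premise would place the other premise inside \<open>C\<close>,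
      which was just excluded.\<close>
    have "\<not> tautological A \<and> \<not> tautological B"
      using subsumed_premise[of A B x C] A resolve.hyps(2,3,5) C(1) by blast
    then have "admissible X A" "admissible X B" using vars by (auto simp: admissible_def)
    then obtain A' B' where A': "A' \<in> set Ds" "A' \<subseteq> A" and B': "B' \<in> set Ds" "B' \<subseteq> B"
      using Ds(3) resolve.hyps(2,3) by blast
    have sub': "w_res x A' B' \<subseteq> C" using A'(2) B'(2) sub by (auto simp: w_res_def)
    \<comment> \<open>Without its pivot literal a strengthened premise would itself be a subset of
      \<open>C\<close>, contrary to \<open>min\<close>.\<close>
    have "Pos x \<in> A'" using min[OF A'(1)] A'(2) sub by blast
    moreover have "Neg x \<in> B'" using min[OF B'(1)] B'(2) sub by blast
    moreover have "admissible X A'" "admissible X B'" "admissible X (w_res x A' B')"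
      using admissible_mono A'(2) B'(2) sub' True \<open>admissible X A\<close> \<open>admissible X B\<close> by blast+
    ultimately have "derivation F X (w_res x A' B' # Ds)"
      using derivation.resolve[OF Ds(1) A'(1) B'(1)] resolve.hyps(4)
      unfolding admissible_def by blast
    then show ?thesis using Ds sub' by (intro exI[of _ "w_res x A' B' # Ds"]) simp
  qed
qed

corollary derivation_of_weak_refutation:
  assumes "weak_derivation F X Cs" "{} \<in> set Cs"
  obtains Ds where "derivation F X Ds" "length Ds \<le> length Cs" "{} \<in> set Ds"
proof -
  have "admissible X {}" by (simp add: admissible_def tautological_def)
  then show ?thesis
    using derivation_of_weak_derivation[OF assms(1)] assms(2) that by (metis subset_empty)
qed

section \<open>Derivations and resolution dags\<close>

text \<open>Reversal puts premises before conclusions. The two positions are kept distinct because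
  an inner dag node needs two different predecessors.\<close>

lemma derivation_nth:
  assumes "derivation F X Ds" "i < length Ds" "rev Ds ! i \<notin> F"
  shows "\<exists>j k x. j < i \<and> k < i \<and> j \<noteq> k \<and> is_resolvent x (rev Ds ! j) (rev Ds ! k) (rev Ds ! i)"
  using assms
proof (induction arbitrary: i)
  case Nil
  then show ?case by simp
next
  case (axiom Ds C)
  then have "i < length Ds" by (auto simp: nth_append less_Suc_eq)
  moreover have "rev Ds ! i \<notin> F" using axiom calculation by (auto simp: nth_append)
  ultimately obtain j k x where "j < i" "k < i" "j \<noteq> k"
    "is_resolvent x (rev Ds ! j) (rev Ds ! k) (rev Ds ! i)" using axiom.IH by blast
  then show ?case using \<open>i < length Ds\<close>
    by (intro exI[of _ j] exI[of _ k] exI[of _ x]) (auto simp: nth_append)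
next
  case (resolve Ds A B x)
  show ?case
  proof (cases "i < length Ds")
    case True
    moreover have "rev Ds ! i \<notin> F" using resolve calculation by (auto simp: nth_append)
    ultimately obtain j k x where "j < i" "k < i" "j \<noteq> k"
      "is_resolvent x (rev Ds ! j) (rev Ds ! k) (rev Ds ! i)" using resolve.IH by blast
    then show ?thesis using \<open>i < length Ds\<close>
      by (intro exI[of _ j] exI[of _ k] exI[of _ x]) (auto simp: nth_append)
  next
    case False
    then have i: "i = length Ds" using resolve by simp
    obtain j where j: "j < length Ds" "rev Ds ! j = A"
      using resolve by (metis in_set_conv_nth length_rev set_rev)
    obtain k where k: "k < length Ds" "rev Ds ! k = B"
      using resolve by (metis in_set_conv_nth length_rev set_rev)
    \<comment> \<open>Equal positions would put \<open>Pos x\<close> and \<open>Neg x\<close> into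
      one non-tautological clause.\<close>
    have "j \<noteq> k" using j k resolve by (auto simp: tautological_def)
    then show ?thesis using i j k resolve
      by (intro exI[of _ j] exI[of _ k] exI[of _ x]) (auto simp: nth_append is_resolvent_def)
  qed
qed

text \<open>The dag consists of the ancestors of one chosen occurrence of the empty clause;
  discarding all other positions makes the sink unique.\<close>

lemma RD_of_derivation:
  assumes "derivation F X Ds" "{} \<in> set Ds"
  shows "\<exists>m\<le>length Ds. RD F m"
proof -
  define n where "n = length Ds"
  define c where "c = (\<lambda>i. rev Ds ! i)"
  obtain r where r: "r < n" "c r = {}"
    using assms(2) unfolding n_def c_def by (metis in_set_conv_nth length_rev set_rev)
  have "\<forall>i. \<exists>j k x. i < n \<longrightarrow> c i \<notin> F \<longrightarrow>
      j < i \<and> k < i \<and> j \<noteq> k \<and> is_resolvent x (c j) (c k) (c i)"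
    using derivation_nth[OF assms(1)] unfolding n_def c_def by blast
  then obtain f g h where fgh: "\<And>i. i < n \<Longrightarrow> c i \<notin> F \<Longrightarrow>
      f i < i \<and> g i < i \<and> f i \<noteq> g i \<and> is_resolvent (h i) (c (f i)) (c (g i)) (c i)"
    by metis
  \<comment> \<open>Positions with a clause of \<open>F\<close> get no incoming edge even if the
    clause is also a resolvent, so every in-degree is 0 or 2.\<close>
  define E0 where "E0 = {(j, i). i < n \<and> c i \<notin> F \<and> (j = f i \<or> j = g i)}"
  define V where "V = {j. (j, r) \<in> E0\<^sup>*}"
  define E where "E = E0 \<inter> V \<times> V"
  have less: "j < i" if "(j, i) \<in> E0" for i j using that fgh unfolding E0_def by blast
  have V_le: "j \<le> r" if "(j, r) \<in> E0\<^sup>*" for j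
    using that by (induction rule: converse_rtrancl_induct) (use less in force)+
  have V_sub: "V \<subseteq> {..<n}" using V_le r unfolding V_def by force
  have pred: "j \<in> V" if "(j, i) \<in> E0" "i \<in> V" for i j
    using that unfolding V_def by (simp add: converse_rtrancl_into_rtrancl)
  have rV: "r \<in> V" unfolding V_def by simp
  \<comment> \<open>A premise of a genuine resolution contains a pivot literal, so no edge leaves an
    empty clause and \<open>r\<close> is a sink. Any other node of \<open>V\<close> has a path to
    \<open>r\<close>, hence an outgoing edge.\<close>
  have nonempty: "c j \<noteq> {}" if "(j, i) \<in> E0" for i j
    using that fgh[of i] unfolding E0_def is_resolvent_def by auto
  have sink: "E `` {v} = {} \<longleftrightarrow> v = r" if v: "v \<in> V" for v
  proof
    assume empty: "E `` {v} = {}"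
    have "(v, r) \<in> E0\<^sup>*" using v unfolding V_def by simp
    then show "v = r"
    proof (cases rule: converse_rtranclE)
      case (step w)
      then have "(v, w) \<in> E" using v unfolding E_def V_def by simp
      then show ?thesis using empty by blast
    qed
  next
    assume "v = r"
    then show "E `` {v} = {}" using r nonempty unfolding E_def by blast
  qed
  \<comment> \<open>\<open>V\<close> is closed under predecessors, so cutting the graph down to
    \<open>V\<close> loses no premise.\<close>
  have conv: "E\<inverse> `` {v} = E0\<inverse> `` {v}" if "v \<in> V" for v
    using that pred unfolding E_def by blast
  have "rd_refutation F V E c h"
    unfolding rd_refutation_def
  proof (intro conjI ballI impI)
    show "finite V" using V_sub finite_subset by blast
    show "E \<subseteq> V \<times> V" unfolding E_def by blast
    have "E \<subseteq> less_than" using less unfolding E_def by auto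
    then show "acyclic E" using acyclic_subset wf_acyclic wf_less_than by blast
    show "\<exists>!v. v \<in> V \<and> E `` {v} = {}" using sink rV by blast
    show "c v = {}" if "v \<in> V" "E `` {v} = {}" for v using that sink r by blast
    show "c v \<in> F" if v: "v \<in> V" "E\<inverse> `` {v} = {}" for v
    proof (rule ccontr)
      assume "c v \<notin> F"
      then have "(f v, v) \<in> E0" using v V_sub unfolding E0_def by auto
      then show False using v conv by blast
    qed
    show "\<exists>u w. u \<noteq> w \<and> E\<inverse> `` {v} = {u, w} \<and> is_resolvent (h v) (c u) (c w) (c v)"
      if v: "v \<in> V" "E\<inverse> `` {v} \<noteq> {}" for v
    proof -
      have vn: "v < n" "c v \<notin> F" using v conv unfolding E0_def by auto
      then have "E\<inverse> `` {v} = {f v, g v}" using conv[OF v(1)] unfolding E0_def by auto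
      then show ?thesis using fgh[OF vn] by blast
    qed
  qed
  moreover have "card V \<le> n" using V_sub by (metis card_lessThan card_mono finite_lessThan)
  ultimately show ?thesis unfolding RD_def n_def by blast
qed

corollary RD_of_weak_refutation:
  "weak_derivation F X Cs \<Longrightarrow> {} \<in> set Cs \<Longrightarrow> \<exists>m\<le>length Cs. RD F m"
  by (meson RD_of_derivation derivation_of_weak_refutation order_trans)

text \<open>The list is a topological order of the dag. The induction runs over predecessor-closed
  sets \<open>W\<close> and removes one node at a time.\<close>

lemma weak_derivation_of_dag:
  assumes rd: "rd_refutation F V E cls var"
    and "W \<subseteq> V" "\<forall>v\<in>W. E\<inverse> `` {v} \<subseteq> W"
  shows "\<exists>Cs. weak_derivation F (var ` V) Cs \<and> length Cs = card W \<and> cls ` W = set Cs"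
  using assms(2-)
proof (induction "card W" arbitrary: W)
  case 0
  have "finite V" using rd unfolding rd_refutation_def by blast
  then have "W = {}" using 0 finite_subset by (metis card_eq_0_iff)
  then show ?case by (auto intro: weak_derivation.Nil)
next
  case (Suc n)
  have fin: "finite V" "E \<subseteq> V \<times> V" "acyclic E" using rd unfolding rd_refutation_def by auto
  then have "finite E" by (meson finite_SigmaI finite_subset)
  \<comment> \<open>A minimal element for the converse of \<open>E\<close> is a node of
    \<open>W\<close> without successor in \<open>W\<close>; removing it keeps the set closed under
    predecessors.\<close>
  then have wf: "wf (E\<inverse>)" using fin(3) by (rule finite_acyclic_wf_converse)
  have "W \<noteq> {}" using Suc.hyps(2) by auto
  then obtain v where v: "v \<in> W" "\<And>u. (u, v) \<in> E\<inverse> \<Longrightarrow> u \<notin> W"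
    using wfE_min'[OF wf] by blast
  have finW: "finite W" using finite_subset[OF Suc.prems(1) fin(1)] .
  have vV: "v \<in> V" using v(1) Suc.prems(1) by blast
  let ?W = "W - {v}"
  have "card ?W = n" using Suc.hyps(2)[symmetric] v(1) finW by simp
  moreover have "\<forall>u\<in>?W. E\<inverse> `` {u} \<subseteq> ?W" using Suc.prems(2) v(2) by blast
  ultimately obtain Cs where Cs: "weak_derivation F (var ` V) Cs" "length Cs = n"
      "cls ` ?W = set Cs"
    using Suc.hyps(1)[of ?W] Suc.prems by blast
  have "weak_derivation F (var ` V) (cls v # Cs)"
  proof (cases "E\<inverse> `` {v} = {}")
    case True
    then have "cls v \<in> F" using rd vV unfolding rd_refutation_def by blast
    then show ?thesis using Cs by (auto intro: weak_derivation.axiom)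
  next
    case False
    have "\<forall>v\<in>V. E\<inverse> `` {v} \<noteq> {} \<longrightarrow>
        (\<exists>u w. u \<noteq> w \<and> E\<inverse> `` {v} = {u, w} \<and> is_resolvent (var v) (cls u) (cls w) (cls v))"
      using rd unfolding rd_refutation_def by (elim conjE)
    from bspec[OF this vV] False obtain u w where uw: "E\<inverse> `` {v} = {u, w}"
        "is_resolvent (var v) (cls u) (cls w) (cls v)"
      by iprover
    have "E\<inverse> `` {v} \<subseteq> W" using Suc.prems(2) v(1) by (rule bspec)
    moreover have "v \<notin> E\<inverse> `` {v}" using v(1) v(2)[of v] by auto
    ultimately have "{u, w} \<subseteq> ?W" using uw(1) by auto
    then have "cls u \<in> set Cs" "cls w \<in> set Cs" using Cs(3) by auto
    then show ?thesis
      using uw(2) vV weak_derivation.resolve[OF Cs(1)] unfolding is_resolvent_def by blast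
  qed
  moreover have "cls ` W = set (cls v # Cs)"
    using Cs(3) v(1) by (metis image_insert insert_Diff list.simps(15))
  ultimately show ?case using Cs Suc.hyps(2) by (intro exI[of _ "cls v # Cs"]) auto
qed

text \<open>The number of variables is bounded together with the length because the size of the tree
  built later depends on both.\<close>

corollary weak_refutation_of_RD:
  assumes "RD F n"
  obtains X Cs where "weak_derivation F X Cs" "length Cs = n" "{} \<in> set Cs"
    "finite X" "card X \<le> n"
proof -
  obtain V E cls var where rd: "rd_refutation F V E cls var" "card V = n"
    using assms unfolding RD_def by blast
  have V: "finite V" "E \<subseteq> V \<times> V" using rd unfolding rd_refutation_def by auto
  then obtain Cs where Cs: "weak_derivation F (var ` V) Cs" "length Cs = n" "cls ` V = set Cs"
    using weak_derivation_of_dag[OF rd(1), of V] rd(2) by blast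
  have "{} \<in> cls ` V" using rd(1) unfolding rd_refutation_def by (metis image_eqI)
  then show ?thesis
    using that[OF Cs(1,2)] Cs(3) V rd(2) card_image_le[of V var] by auto
qed

section \<open>Restrictions\<close>

text \<open>Satisfied clauses are dropped and the others lose their false literals. A resolution on
  an unassigned variable survives; one on an assigned variable turns into a weakening of a single
  premise.\<close>

lemma weak_derivation_restrict:
  assumes "weak_derivation F X Cs"
  shows "\<exists>Ds. weak_derivation (cnf_of (restrict_cnf \<alpha> F)) X Ds \<and> length Ds \<le> length Cs \<and>
    (\<forall>C\<in>set Cs. (\<forall>l\<in>C. lit_val \<alpha> l \<noteq> Some True) \<longrightarrow> {l\<in>C. lit_val \<alpha> l = None} \<in> set Ds)"
  using assms
proof induction
  case Nil
  then show ?case by (auto intro: weak_derivation.Nil)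
next
  case (axiom Cs A C)
  let ?G = "cnf_of (restrict_cnf \<alpha> F)"
  obtain Ds where Ds: "weak_derivation ?G X Ds" "length Ds \<le> length Cs"
    "\<forall>C\<in>set Cs. (\<forall>l\<in>C. lit_val \<alpha> l \<noteq> Some True) \<longrightarrow> {l\<in>C. lit_val \<alpha> l = None} \<in> set Ds"
    using axiom.IH by blast
  show ?case
  proof (cases "\<forall>l\<in>C. lit_val \<alpha> l \<noteq> Some True")
    case True
    then have A: "\<forall>l\<in>A. lit_val \<alpha> l \<noteq> Some True" using axiom by blast
    \<comment> \<open>If the restricted formula is \<open>Zero\<close>, it is read as
      \<open>{{}}\<close>, and the empty clause is below everything. Otherwise \<open>A\<close>
      itself restricts to a \<open>Rest\<close> clause, which also rules out
      \<open>One\<close>.\<close>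
    have "\<exists>B\<in>?G. B \<subseteq> {l\<in>A. lit_val \<alpha> l = None}"
    proof (cases "\<exists>C\<in>F. restrict_clause \<alpha> C = Zero")
      case True
      then show ?thesis by (simp add: restrict_cnf_def)
    next
      case False
      then have "restrict_clause \<alpha> A = Rest {l\<in>A. lit_val \<alpha> l = None}"
        using A axiom.hyps by (auto simp: restrict_clause_def split: if_splits)
      moreover have "\<not> (\<forall>C\<in>F. restrict_clause \<alpha> C = One)"
        using calculation axiom.hyps(2) by (metis restricted.distinct(5))
      ultimately show ?thesis using False axiom.hyps by (auto simp: restrict_cnf_def)
    qed
    then obtain B where "B \<in> ?G" "B \<subseteq> {l\<in>C. lit_val \<alpha> l = None}" using axiom.hyps by blast
    then have "weak_derivation ?G X ({l\<in>C. lit_val \<alpha> l = None} # Ds)"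
      using Ds weak_derivation.axiom by blast
    then show ?thesis using Ds
      by (intro exI[of _ "{l\<in>C. lit_val \<alpha> l = None} # Ds"]) auto
  next
    case False
    then show ?thesis using Ds by (intro exI[of _ Ds]) auto
  qed
next
  case (weaken Cs A C)
  let ?G = "cnf_of (restrict_cnf \<alpha> F)"
  obtain Ds where Ds: "weak_derivation ?G X Ds" "length Ds \<le> length Cs"
    "\<forall>C\<in>set Cs. (\<forall>l\<in>C. lit_val \<alpha> l \<noteq> Some True) \<longrightarrow> {l\<in>C. lit_val \<alpha> l = None} \<in> set Ds"
    using weaken.IH by blast
  show ?case
  proof (cases "\<forall>l\<in>C. lit_val \<alpha> l \<noteq> Some True")
    case True
    then have "{l\<in>A. lit_val \<alpha> l = None} \<in> set Ds" using Ds weaken.hyps by blast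
    moreover have "{l\<in>A. lit_val \<alpha> l = None} \<subseteq> {l\<in>C. lit_val \<alpha> l = None}" using weaken.hyps by blast
    ultimately have "weak_derivation ?G X ({l\<in>C. lit_val \<alpha> l = None} # Ds)"
      using Ds weak_derivation.weaken by blast
    then show ?thesis using Ds
      by (intro exI[of _ "{l\<in>C. lit_val \<alpha> l = None} # Ds"]) auto
  next
    case False
    then show ?thesis using Ds by (intro exI[of _ Ds]) auto
  qed
next
  case (resolve Cs A B x C)
  let ?G = "cnf_of (restrict_cnf \<alpha> F)"
  obtain Ds where Ds: "weak_derivation ?G X Ds" "length Ds \<le> length Cs"
    "\<forall>C\<in>set Cs. (\<forall>l\<in>C. lit_val \<alpha> l \<noteq> Some True) \<longrightarrow> {l\<in>C. lit_val \<alpha> l = None} \<in> set Ds"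
    using resolve.IH by blast
  show ?case
  proof (cases "\<forall>l\<in>C. lit_val \<alpha> l \<noteq> Some True")
    case C: True
    let ?r = "\<lambda>C. {l\<in>C. lit_val \<alpha> l = None}"
    have sub: "A - {Pos x} \<subseteq> C" "B - {Neg x} \<subseteq> C" using resolve.hyps by (auto simp: w_res_def)
    have "weak_derivation ?G X (?r C # Ds)"
    proof (cases "\<alpha> x")
      case None
      then have "\<forall>l\<in>insert (Pos x) (insert (Neg x) C). lit_val \<alpha> l \<noteq> Some True"
        using C by simp
      then have "\<forall>l\<in>A. lit_val \<alpha> l \<noteq> Some True" "\<forall>l\<in>B. lit_val \<alpha> l \<noteq> Some True"
        using sub by blast+
      then have "?r A \<in> set Ds" "?r B \<in> set Ds" using Ds(3) resolve.hyps(2,3) by blast+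
      moreover have "w_res x (?r A) (?r B) \<subseteq> ?r C" using sub by (auto simp: w_res_def)
      ultimately show ?thesis 
        using weak_derivation.resolve[OF Ds(1) _ _ resolve.hyps(4)] by blast
    next
      \<comment> \<open>If \<open>x\<close> is true, \<open>B\<close> has no true literal and
        restriction deletes \<open>Neg x\<close> from it, so its restriction lies inside that of
        \<open>C\<close>. If \<open>x\<close> is false, the same holds for \<open>A\<close> and
        \<open>Pos x\<close>.\<close>
      case (Some b)
      show ?thesis
      proof (cases b)
        case True
        then have "\<forall>l\<in>insert (Neg x) C. lit_val \<alpha> l \<noteq> Some True" using C Some by simp
        then have "\<forall>l\<in>B. lit_val \<alpha> l \<noteq> Some True" using sub by blast
        then have "?r B \<in> set Ds" using Ds(3) resolve.hyps(3) by blast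
        moreover have "?r B \<subseteq> ?r C" using sub Some by auto
        ultimately show ?thesis using Ds(1) weak_derivation.weaken by blast
      next
        case False
        then have "\<forall>l\<in>insert (Pos x) C. lit_val \<alpha> l \<noteq> Some True" using C Some by simp
        then have "\<forall>l\<in>A. lit_val \<alpha> l \<noteq> Some True" using sub by blast
        then have "?r A \<in> set Ds" using Ds(3) resolve.hyps(2) by blast
        moreover have "?r A \<subseteq> ?r C" using sub Some by auto
        ultimately show ?thesis using Ds(1) weak_derivation.weaken by blast
      qed
    qed
    then show ?thesis using Ds by (intro exI[of _ "?r C # Ds"]) auto
  next
    case False
    then show ?thesis using Ds by (intro exI[of _ Ds]) auto
  qed
qed

lemma RD_restrict:
  assumes "RD F n"
  shows "\<exists>m\<le>n. RD (cnf_of (restrict_cnf \<alpha> F)) m"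
proof -
  obtain X Cs where Cs: "weak_derivation F X Cs" "length Cs = n" "{} \<in> set Cs"
    using weak_refutation_of_RD[OF assms] by metis
  then obtain Ds where Ds: "weak_derivation (cnf_of (restrict_cnf \<alpha> F)) X Ds" "length Ds \<le> n"
      "{} \<in> set Ds"
    using weak_derivation_restrict[OF Cs(1), of \<alpha>] by fastforce
  then show ?thesis using RD_of_weak_refutation by (meson order_trans)
qed

lemma cnf_restrict:
  assumes "cnf F"
  shows "cnf (cnf_of (restrict_cnf \<alpha> F))"
proof -
  let ?D = "{D. \<exists>C\<in>F. restrict_clause \<alpha> C = Rest D}"
  have "?D \<subseteq> (\<lambda>C. {l\<in>C. lit_val \<alpha> l = None}) ` F"
    by (auto simp: restrict_clause_def split: if_splits)
  moreover have "cnf ((\<lambda>C. {l\<in>C. lit_val \<alpha> l = None}) ` F)" using assms by (auto simp: cnf_def)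
  ultimately have "cnf ?D" unfolding cnf_def by (meson finite_subset subsetD)
  then show ?thesis by (auto simp: restrict_cnf_def cnf_def)
qed

section \<open>From trees with lemmas to dags\<close>

lemma label_in_postorder: "T \<in> set (postorder T)"
  by (cases T) auto

text \<open>A leaf may reuse the label of any earlier node of the whole tree, not only of the
  current subtree. The induction therefore carries the list \<open>ps\<close> of nodes visited
  before \<open>T\<close>.\<close>

lemma weak_derivation_postorder:
  assumes "weak_derivation F UNIV (rev (map label ps))"
    and "\<forall>v < length (ps @ postorder T). \<forall>C. (ps @ postorder T) ! v = Leaf C \<longrightarrow>
        C \<in> F \<or> (\<exists>u < v. label ((ps @ postorder T) ! u) = C)"
    and "\<forall>l x C r. Infer l x C r \<in> set (postorder T) \<longrightarrow> is_w_resolvent x (label l) (label r) C"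
  shows "weak_derivation F UNIV (rev (map label (ps @ postorder T)))"
  using assms
proof (induction T arbitrary: ps)
  case (Leaf C)
  have "C \<in> F \<or> (\<exists>u < length ps. label (ps ! u) = C)"
    using Leaf(2) by (auto simp: nth_append dest!: spec[of _ "length ps"])
  then show ?case
  proof
    assume "C \<in> F"
    then show ?thesis using Leaf(1) by (auto intro: weak_derivation.axiom)
  next
    assume "\<exists>u < length ps. label (ps ! u) = C"
    then have "C \<in> set (rev (map label ps))" by auto
    then have "weak_derivation F UNIV (C # rev (map label ps))"
      using weak_derivation.weaken[OF Leaf(1)] by blast
    then show ?thesis by simp
  qed
next
  case (Infer l x C r)
  \<comment> \<open>The leaf condition refers only to earlier positions, so it passes to every
    initial segment.\<close>
  have prefix: "\<forall>v < length qs. \<forall>C. qs ! v = Leaf C \<longrightarrow> C \<in> F \<or> (\<exists>u < v. label (qs ! u) = C)"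
    if q: "ps @ postorder (Infer l x C r) = qs @ rs" for qs rs
  proof (intro allI impI)
    fix v D assume v: "v < length qs" "qs ! v = Leaf D"
    have "D \<in> F \<or> (\<exists>u < v. label ((qs @ rs) ! u) = D)"
      using Infer.prems(2)[unfolded q, rule_format, of v D] v by (simp add: nth_append)
    then show "D \<in> F \<or> (\<exists>u < v. label (qs ! u) = D)"
      using v(1) by (metis nth_append order.strict_trans)
  qed
  let ?qs = "ps @ postorder l" and ?rs = "(ps @ postorder l) @ postorder r"
  have "weak_derivation F UNIV (rev (map label ?qs))"
    by (rule Infer.IH(1)[OF Infer.prems(1)], rule prefix) (use Infer.prems(3) in auto)
  then have rs: "weak_derivation F UNIV (rev (map label ?rs))"
    by (rule Infer.IH(2), intro prefix) (use Infer.prems(3) in auto)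
  have "label l \<in> set (rev (map label ?rs))" "label r \<in> set (rev (map label ?rs))"
    using label_in_postorder[of l] label_in_postorder[of r] by auto
  moreover have "is_w_resolvent x (label l) (label r) C" using Infer.prems(3) by simp
  ultimately have "weak_derivation F UNIV (C # rev (map label ?rs))"
    using weak_derivation.resolve[OF rs] unfolding is_w_resolvent_def by blast
  then show ?case by simp
qed

lemma RD_of_regWRTL:
  assumes "regWRTL F n"
  shows "\<exists>m\<le>n. RD F m"
proof -
  obtain T where T: "regWRTL_refutation F T" "tree_size T = n"
    using assms unfolding regWRTL_def by blast
  have "weak_derivation F UNIV (rev (map label ([] @ postorder T)))"
    by (rule weak_derivation_postorder)
      (use T(1) in \<open>simp_all add: regWRTL_refutation_def weak_derivation.Nil\<close>)
  then have "weak_derivation F UNIV (rev (map label (postorder T)))" by simp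
  moreover have "{} \<in> set (rev (map label (postorder T)))"
    using imageI[OF label_in_postorder[of T], of label] T(1) by (simp add: regWRTL_refutation_def)
  ultimately have "\<exists>m\<le>length (rev (map label (postorder T))). RD F m"
    by (rule RD_of_weak_refutation)
  then show ?thesis using T(2) unfolding tree_size_def by simp
qed

lemma regWRTL_of_regWRTI: "regWRTI F n \<Longrightarrow> regWRTL F n"
  unfolding regWRTI_def regWRTL_def regWRTI_refutation_def by blast

section \<open>From dags to trees with lemmas for an extended formula\<close>

definition sound_tree :: "'v rtree \<Rightarrow> bool" where
  "sound_tree T \<longleftrightarrow>
     (\<forall>l x C r. Infer l x C r \<in> set (postorder T) \<longrightarrow> is_w_resolvent x (label l) (label r) C)"

lemma sound_tree_simps [simp]:
  "sound_tree (Leaf C)"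
  "sound_tree (Infer l x C r) \<longleftrightarrow>
     sound_tree l \<and> sound_tree r \<and> is_w_resolvent x (label l) (label r) C"
  unfolding sound_tree_def by auto

text \<open>Besides regularity this records a set containing all inference variables, so that a
  variable outside it can safely be used at a new root.\<close>

definition regular_over :: "'v set \<Rightarrow> 'v rtree \<Rightarrow> bool" where
  "regular_over Y T \<longleftrightarrow> (\<forall>p\<in>path_vars T. distinct p \<and> set p \<subseteq> Y)"

lemma regular_over_Leaf [simp]: "regular_over Y (Leaf C)"
  by (simp add: regular_over_def)

lemma regular_over_mono: "regular_over Y T \<Longrightarrow> Y \<subseteq> Z \<Longrightarrow> regular_over Z T"
  unfolding regular_over_def by blast

lemma regular_over_Infer:
  assumes "regular_over Y l" "regular_over Y r" "x \<notin> Y"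
  shows "regular_over (insert x Y) (Infer l x C r)"
  using assms unfolding regular_over_def by auto

definition input_lemmas :: "'v clause set \<Rightarrow> 'v rtree list \<Rightarrow> bool" where
  "input_lemmas F ps \<longleftrightarrow> (\<forall>v < length ps. \<forall>C. ps ! v = Leaf C \<longrightarrow>
     C \<in> F \<or> (\<exists>u < v. input_tree (ps ! u) \<and> label (ps ! u) = C))"

text \<open>It suffices here that new leaves draw on lemmas from the old part \<open>ps\<close>: in
  the construction everything that a right subtree reuses is learned in the left one.\<close>

lemma input_lemmas_append:
  assumes "input_lemmas F ps"
    and qs: "\<And>C. Leaf C \<in> set qs \<Longrightarrow> C \<in> F \<or> (\<exists>u\<in>set ps. input_tree u \<and> label u = C)"
  shows "input_lemmas F (ps @ qs)"
  unfolding input_lemmas_def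
proof (intro allI impI)
  fix v C assume v: "v < length (ps @ qs)" "(ps @ qs) ! v = Leaf C"
  show "C \<in> F \<or> (\<exists>u < v. input_tree ((ps @ qs) ! u) \<and> label ((ps @ qs) ! u) = C)"
  proof (cases "v < length ps")
    case True
    then have "C \<in> F \<or> (\<exists>u < v. input_tree (ps ! u) \<and> label (ps ! u) = C)"
      using assms(1) v unfolding input_lemmas_def by (auto simp: nth_append)
    then show ?thesis using True by (metis nth_append order.strict_trans)
  next
    case False
    then have "qs ! (v - length ps) = Leaf C" using v by (simp add: nth_append)
    moreover have "v - length ps < length qs" using v False by simp
    ultimately have "Leaf C \<in> set qs" by (metis nth_mem)
    then consider "C \<in> F" | u where "u < length ps" "input_tree (ps ! u)" "label (ps ! u) = C"
      using qs by (metis in_set_conv_nth)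
    then show ?thesis
    proof cases
      case 2
      then show ?thesis using False by (intro disjI2 exI[of _ u]) (simp add: nth_append)
    qed simp
  qed
qed

lemma regWRTI_refutation_iff:
  "regWRTI_refutation F T \<longleftrightarrow>
     input_lemmas F (postorder T) \<and> sound_tree T \<and> label T = {} \<and> regular T"
  unfolding regWRTI_refutation_def regWRTL_refutation_def input_lemmas_def sound_tree_def by blast

text \<open>Resolving against the clauses \<open>{q, negate l}\<close> turns any non-tautological clause into a subset of \<open>{q}\<close>.\<close>

fun absorb :: "'v literal \<Rightarrow> 'v rtree \<Rightarrow> 'v literal list \<Rightarrow> 'v rtree" where
  "absorb q T [] = T"
| "absorb q T (l # ls) =
     absorb q (Infer T (var_of l) ((label T - {l}) \<union> {q}) (Leaf {q, negate l})) ls"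

lemma label_absorb: "label (absorb q T ls) \<subseteq> (label T - set ls) \<union> {q}"
proof (induction ls arbitrary: T)
  case (Cons l ls)
  from Cons[of "Infer T (var_of l) ((label T - {l}) \<union> {q}) (Leaf {q, negate l})"]
  show ?case by auto
qed auto

lemma tree_size_absorb: "tree_size (absorb q T ls) = tree_size T + 2 * length ls"
  by (induction ls arbitrary: T) (auto simp: tree_size_def)

lemma postorder_absorb: "set (postorder T) \<subseteq> set (postorder (absorb q T ls))"
proof (induction ls arbitrary: T)
  case (Cons l ls)
  from Cons[of "Infer T (var_of l) ((label T - {l}) \<union> {q}) (Leaf {q, negate l})"]
  show ?case by auto
qed simp

lemma leaf_absorb:
  "Leaf C \<in> set (postorder (absorb q T ls)) \<Longrightarrow>
     Leaf C \<in> set (postorder T) \<or> (\<exists>l\<in>set ls. C = {q, negate l})"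
  by (induction ls arbitrary: T) fastforce+

lemma w_resolvent_absorb:
  assumes "var_of l \<noteq> var_of q"
  shows "is_w_resolvent (var_of l) A {q, negate l} ((A - {l}) \<union> {q})"
proof (cases l)
  case (Pos x)
  then have "w_res x A {q, negate l} = (A - {l}) \<union> {q}" using assms by (auto simp: w_res_def)
  then show ?thesis using Pos by (simp add: is_w_resolvent_def)
next
  case (Neg x)
  then have "w_res x {q, negate l} A = (A - {l}) \<union> {q}" using assms by (auto simp: w_res_def)
  then show ?thesis using Neg by (simp add: is_w_resolvent_def)
qed

lemma sound_tree_absorb:
  assumes "sound_tree T" "var_of q \<notin> var_of ` set ls"
  shows "sound_tree (absorb q T ls)"
  using assms
proof (induction ls arbitrary: T)
  case (Cons l ls)
  have "is_w_resolvent (var_of l) (label T) {q, negate l} ((label T - {l}) \<union> {q})"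
    using Cons.prems(2) by (intro w_resolvent_absorb) auto
  then show ?case
    unfolding absorb.simps using Cons.prems by (intro Cons.IH) auto
qed simp

lemma regular_over_absorb:
  assumes "regular_over Y T" "distinct (map var_of ls)" "var_of ` set ls \<inter> Y = {}"
  shows "regular_over (Y \<union> var_of ` set ls) (absorb q T ls)"
  using assms
proof (induction ls arbitrary: T Y)
  case (Cons l ls)
  have "regular_over (insert (var_of l) Y)
      (Infer T (var_of l) ((label T - {l}) \<union> {q}) (Leaf {q, negate l}))"
    using Cons.prems by (intro regular_over_Infer) auto
  then have "regular_over (insert (var_of l) Y \<union> var_of ` set ls) (absorb q T (l # ls))"
    unfolding absorb.simps using Cons.prems by (intro Cons.IH) auto
  then show ?case by simp
qed simp

text \<open>Meant for a tree \<open>T\<close> that learns \<open>C\<close> by one resolution, with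
  \<open>Y\<close> holding its pivot. Each literal of \<open>C\<close> costs one inference and one
  leaf, hence the summand \<open>2 * card X\<close>.\<close>

lemma absorb_clause:
  assumes "label T = C" "sound_tree T" "regular_over Y T" "finite X" "var_of ` C \<subseteq> X" "Y \<subseteq> X"
    and "\<not> tautological C" "var_of ` C \<inter> Y = {}" "var_of q \<notin> X"
  shows "\<exists>M. label M \<subseteq> {q} \<and> sound_tree M \<and> regular_over X M \<and>
    tree_size M \<le> tree_size T + 2 * card X \<and> T \<in> set (postorder M) \<and>
    (\<forall>D. Leaf D \<in> set (postorder M) \<longrightarrow>
       Leaf D \<in> set (postorder T) \<or> (\<exists>l\<in>Pos ` X \<union> Neg ` X. D = {q, l}))"
proof -
  \<comment> \<open>Distinct literals of a non-tautological clause have distinct variables. This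
    yields finiteness of \<open>C\<close>, the bound on its length, and regularity of the
    absorption.\<close>
  have inj: "inj_on var_of C"
  proof (rule inj_onI)
    fix a b assume "a \<in> C" "b \<in> C" "var_of a = var_of b"
    then show "a = b" using assms(7) unfolding tautological_def by (cases a; cases b) auto
  qed
  have "finite C" using inj assms(4,5) finite_imageD finite_subset by blast
  then obtain ls where ls: "set ls = C" "distinct ls" using finite_distinct_list by blast
  then have dist: "distinct (map var_of ls)" using inj by (simp add: distinct_map)
  have "length ls = card (var_of ` C)" using ls inj by (metis card_image distinct_card)
  then have len: "length ls \<le> card X" using assms(4,5) by (simp add: card_mono)
  have neg: "negate l \<in> Pos ` X \<union> Neg ` X" if "l \<in> C" for l
    using that assms(5) by (cases l) force+
  let ?M = "absorb q T ls"
  have "regular_over (Y \<union> var_of ` set ls) ?M"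
    using assms ls dist by (intro regular_over_absorb) auto
  then have "regular_over X ?M" by (rule regular_over_mono) (use assms(5,6) ls in auto)
  moreover have "sound_tree ?M" using assms(2,5,9) ls by (intro sound_tree_absorb) auto
  moreover have "label ?M \<subseteq> {q}" using label_absorb[of q T ls] assms(1) ls by auto
  moreover have "T \<in> set (postorder ?M)" using postorder_absorb label_in_postorder by blast
  moreover have "Leaf D \<in> set (postorder T) \<or> (\<exists>l\<in>Pos ` X \<union> Neg ` X. D = {q, l})"
    if "Leaf D \<in> set (postorder ?M)" for D
    using leaf_absorb[OF that] neg ls(1) by blast
  ultimately show ?thesis using len by (intro exI[of _ ?M]) (simp add: tree_size_absorb)
qed

section \<open>The extended formula and its regWRTI refutation\<close>

definition extension :: "'v literal \<Rightarrow> 'v set \<Rightarrow> 'v clause set \<Rightarrow> 'v clause set" where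
  "extension q X F = insert {q} (F \<union> (\<lambda>l. {q, l}) ` (Pos ` X \<union> Neg ` X))"

text \<open>The clauses of the derivation are learned one after the other as lemmas, each derived from
  two leaves and then absorbed into \<open>{q}\<close>. The parts are joined by w-resolutions on the variables
  \<open>p i\<close>, which occur in no clause, so that no variable of the derivation is used below them.\<close>

lemma lemma_tree_of_derivation:
  fixes p :: "nat \<Rightarrow> 'v"
  assumes "derivation F X Ds" and X: "finite X" "var_of q \<notin> X"
    and p: "inj p" "range p \<inter> insert (var_of q) X = {}"
  shows "\<exists>T. label T = {q} \<and> sound_tree T \<and> regular_over (X \<union> p ` {..<length Ds}) T \<and>
    input_lemmas (extension q X F) (postorder T) \<and>
    tree_size T \<le> 1 + length Ds * (2 * card X + 4) \<and>
    (\<forall>D\<in>set Ds. D \<in> F \<or> (\<exists>u\<in>set (postorder T). input_tree u \<and> label u = D))"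
  using assms(1)
proof induction
  case Nil
  show ?case
    by (intro exI[of _ "Leaf {q}"]) (auto simp: input_lemmas_def extension_def tree_size_def)
next
  case (axiom Ds C)
  then obtain T where T: "label T = {q}" "sound_tree T" "regular_over (X \<union> p ` {..<length Ds}) T"
    "input_lemmas (extension q X F) (postorder T)"
    "tree_size T \<le> 1 + length Ds * (2 * card X + 4)"
    "\<forall>D\<in>set Ds. D \<in> F \<or> (\<exists>u\<in>set (postorder T). input_tree u \<and> label u = D)"
    by blast
  \<comment> \<open>A clause of \<open>F\<close> can label a leaf directly, so nothing is learned;
    the tree stays and only the permitted variable set grows.\<close>
  have "regular_over (X \<union> p ` {..<length (C # Ds)}) T"
    using T(3) by (rule regular_over_mono) auto
  then show ?case using T axiom.hyps(2) by (intro exI[of _ T]) auto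
next
  case (resolve Ds A B x)
  then obtain S where S: "label S = {q}" "sound_tree S" "regular_over (X \<union> p ` {..<length Ds}) S"
    "input_lemmas (extension q X F) (postorder S)"
    "tree_size S \<le> 1 + length Ds * (2 * card X + 4)"
    "\<forall>D\<in>set Ds. D \<in> F \<or> (\<exists>u\<in>set (postorder S). input_tree u \<and> label u = D)"
    by blast
  let ?C = "w_res x A B" and ?y = "p (length Ds)"
  let ?I = "Infer (Leaf A) x ?C (Leaf B)"
  \<comment> \<open>As the premises are not tautological, the pivot disappears with both signs, and
    absorbing the resolvent never repeats it.\<close>
  have x: "x \<notin> var_of ` ?C"
  proof
    assume "x \<in> var_of ` ?C"
    then obtain l where "l \<in> ?C" "x = var_of l" by blast
    then have "Pos x \<in> ?C \<or> Neg x \<in> ?C" by (cases l) auto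
    then show False
      using resolve.hyps(4-7) unfolding w_res_def tautological_def by blast
  qed
  have "regular_over {x} ?I" by (simp add: regular_over_def)
  then obtain M where M: "label M \<subseteq> {q}" "sound_tree M" "regular_over X M"
    "tree_size M \<le> tree_size ?I + 2 * card X" "?I \<in> set (postorder M)"
    "\<And>D. Leaf D \<in> set (postorder M) \<Longrightarrow>
       Leaf D \<in> set (postorder ?I) \<or> (\<exists>l\<in>Pos ` X \<union> Neg ` X. D = {q, l})"
    using absorb_clause[of ?I ?C "{x}" X q] X x resolve.hyps
    by (auto simp: is_w_resolvent_def)
  \<comment> \<open>\<open>S\<close> stands on the left so that its lemmas precede \<open>M\<close>
    in post-order. The w-resolution on the fresh \<open>?y\<close> removes nothing, so it returns
    the union of \<open>{q}\<close> and a subset of \<open>{q}\<close>.\<close>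
  let ?T = "Infer S ?y {q} M"
  have y: "?y \<noteq> var_of q" "?y \<notin> X" using p(2) rangeI[of p "length Ds"] by fastforce+
  then have "is_w_resolvent ?y {q} (label M) {q}"
    using M(1) unfolding is_w_resolvent_def w_res_def by auto
  then have sound: "sound_tree ?T" using S(1,2) M(2) by simp
  have "regular_over (X \<union> p ` {..<length Ds}) M" using M(3) by (rule regular_over_mono) auto
  moreover have "?y \<notin> X \<union> p ` {..<length Ds}" using y p(1) by (auto dest: injD)
  ultimately have "regular_over (insert ?y (X \<union> p ` {..<length Ds})) ?T"
    using S(3) by (intro regular_over_Infer)
  then have reg: "regular_over (X \<union> p ` {..<length (?C # Ds)}) ?T"
    by (rule regular_over_mono) auto
  have "input_lemmas (extension q X F) (postorder S @ (postorder M @ [?T]))"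
  proof (rule input_lemmas_append[OF S(4)])
    fix D assume "Leaf D \<in> set (postorder M @ [?T])"
    then consider "D = A" | "D = B" | "\<exists>l\<in>Pos ` X \<union> Neg ` X. D = {q, l}" using M(6) by auto
    then show "D \<in> extension q X F \<or> (\<exists>u\<in>set (postorder S). input_tree u \<and> label u = D)"
    proof cases
      case 3
      then show ?thesis unfolding extension_def by blast
    qed (use S(6) resolve.hyps(2,3) in \<open>auto simp: extension_def\<close>)
  qed
  then have lem: "input_lemmas (extension q X F) (postorder ?T)" by simp
  \<comment> \<open>The increment \<open>2 * card X + 4\<close> counts three nodes for
    \<open>?I\<close>, at most \<open>2 * card X\<close> for the absorption, and one for the new
    root.\<close>
  have size: "tree_size ?T \<le> 1 + length (?C # Ds) * (2 * card X + 4)"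
    using S(5) M(4) by (simp add: tree_size_def)
  have "input_tree ?I"
    using resolve.hyps(4,5) by (auto simp: input_tree_def is_resolvent_def)
  then have "\<exists>u\<in>set (postorder ?T). input_tree u \<and> label u = ?C"
    using M(5) by (intro bexI[of _ ?I]) auto
  moreover have "set (postorder S) \<subseteq> set (postorder ?T)" by auto
  ultimately have "\<forall>D\<in>set (?C # Ds). D \<in> F \<or> (\<exists>u\<in>set (postorder ?T). input_tree u \<and> label u = D)"
    using S(6) by (metis set_ConsD subsetD)
  then show ?case using sound reg lem size by (intro exI[of _ ?T]) simp
qed

lemma regWRTI_extension:
  fixes p :: "nat \<Rightarrow> 'v"
  assumes "derivation F X Ds" "{} \<in> set Ds" and X: "finite X" "var_of q \<notin> X"
    and p: "inj p" "range p \<inter> insert (var_of q) X = {}"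
  shows "\<exists>m \<le> 3 + length Ds * (2 * card X + 4). regWRTI (extension q X F) m"
proof -
  let ?G = "extension q X F"
  obtain T where T: "label T = {q}" "sound_tree T" "regular_over (X \<union> p ` {..<length Ds}) T"
    "input_lemmas ?G (postorder T)" "tree_size T \<le> 1 + length Ds * (2 * card X + 4)"
    "\<forall>D\<in>set Ds. D \<in> F \<or> (\<exists>u\<in>set (postorder T). input_tree u \<and> label u = D)"
    using lemma_tree_of_derivation[OF assms(1) X p] by blast
  \<comment> \<open>The leaf \<open>{}\<close> is a clause of \<open>F\<close> or a lemma learned in
    \<open>T\<close>. It lacks the negation of \<open>q\<close>, so this inference is only a
    w-resolution; it deletes \<open>q\<close>, whose variable is not resolved on in
    \<open>T\<close>.\<close>
  let ?R = "Infer T (var_of q) {} (Leaf {})"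
  have "is_w_resolvent (var_of q) {q} {} {}"
    by (cases q) (auto simp: is_w_resolvent_def w_res_def)
  then have "sound_tree ?R" using T(1,2) by simp
  moreover have "regular_over (insert (var_of q) (X \<union> p ` {..<length Ds})) ?R"
    using T(3) X p(2) by (intro regular_over_Infer) auto
  then have "regular ?R" unfolding regular_over_def regular_def by blast
  moreover have "input_lemmas ?G (postorder T @ [Leaf {}, ?R])"
    using T(4,6) assms(2) by (intro input_lemmas_append) (auto simp: extension_def)
  ultimately have "regWRTI_refutation ?G ?R" by (simp add: regWRTI_refutation_iff)
  moreover have "tree_size ?R \<le> 3 + length Ds * (2 * card X + 4)"
    using T(5) by (simp add: tree_size_def)
  ultimately show ?thesis unfolding regWRTI_def by blast
qed

lemma cnf_extension: "cnf F \<Longrightarrow> finite X \<Longrightarrow> cnf (extension q X F)"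
  by (auto simp: cnf_def extension_def)

text \<open>All added clauses contain \<open>Pos x\<close> and are satisfied, while freshness leaves
  \<open>F\<close> untouched. The first two assumptions exclude the results \<open>One\<close> and
  \<open>Zero\<close>.\<close>

lemma restrict_extension:
  assumes "F \<noteq> {}" "{} \<notin> F" and fresh: "\<And>C. C \<in> F \<Longrightarrow> x \<notin> var_of ` C"
  shows "restrict_cnf [x \<mapsto> True] (extension (Pos x) X F) = Rest F"
proof -
  let ?\<alpha> = "[x \<mapsto> True]" and ?G = "extension (Pos x) X F"
  have F: "restrict_clause ?\<alpha> C = Rest C" if "C \<in> F" for C
  proof -
    have "lit_val ?\<alpha> l = None" if "l \<in> C" for l
      using fresh[OF \<open>C \<in> F\<close>] that by (cases l) force+
    moreover have "C \<noteq> {}" using that assms(2) by blast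
    ultimately show ?thesis by (auto simp: restrict_clause_def)
  qed
  have "restrict_clause ?\<alpha> C = One" if "Pos x \<in> C" for C
    using that by (auto simp: restrict_clause_def intro!: bexI[of _ "Pos x"])
  then have One: "restrict_clause ?\<alpha> C = One" if "C \<in> ?G" "C \<notin> F" for C
    using that unfolding extension_def by blast
  have "F \<subseteq> ?G" unfolding extension_def by blast
  then have "{D. \<exists>C\<in>?G. restrict_clause ?\<alpha> C = Rest D} = F"
    using F One by (auto; metis restricted.distinct(5) restricted.inject)
  moreover have "\<not> (\<exists>C\<in>?G. restrict_clause ?\<alpha> C = Zero)"
    using F One by (metis restricted.distinct(1,3))
  moreover have "\<not> (\<forall>C\<in>?G. restrict_clause ?\<alpha> C = One)"
    using F assms(1) \<open>F \<subseteq> ?G\<close> by (metis ex_in_conv restricted.distinct(5) subsetD)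
  ultimately show ?thesis unfolding restrict_cnf_def by simp
qed

lemma derivation_empty: "derivation {} X Ds \<Longrightarrow> Ds = []"
  by (induction rule: derivation.induct) auto

lemma regWRTI_of_RD_extension:
  fixes F :: "'v::infinite clause set"
  assumes "cnf F" "{} \<notin> F" "RD F n"
  shows "\<exists>G \<alpha>. \<exists>m \<le> 3 + n * (2 * n + 4). cnf G \<and> cnf_of (restrict_cnf \<alpha> G) = F \<and> regWRTI G m"
proof -
  obtain X Cs where X: "weak_derivation F X Cs" "length Cs = n" "{} \<in> set Cs"
    "finite X" "card X \<le> n"
    using weak_refutation_of_RD[OF assms(3)] by metis
  obtain Ds where Ds: "derivation F X Ds" "length Ds \<le> n" "{} \<in> set Ds"
    using derivation_of_weak_refutation[OF X(1,3)] X(2) by metis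
  \<comment> \<open>\<open>X\<close> need not consist of variables of \<open>F\<close>, so the fresh
    variables must avoid both. Then \<open>f 0\<close> serves as the variable of \<open>q\<close>,
    and the later values of \<open>f\<close> join the pieces of the tree.\<close>
  define Y where "Y = X \<union> (\<Union>C\<in>F. var_of ` C)"
  have "finite Y" using X(4) assms(1) unfolding Y_def cnf_def by blast
  then have "infinite (- Y)" by (metis finite_compl infinite_UNIV)
  then obtain f :: "nat \<Rightarrow> 'v" where f: "inj f" "range f \<subseteq> - Y"
    using infinite_countable_subset by blast
  let ?q = "Pos (f 0)" and ?p = "f \<circ> Suc"
  have q: "var_of ?q \<notin> X" using f(2) unfolding Y_def by auto
  have "inj ?p" using f(1) by (simp add: inj_compose)
  moreover have "range ?p \<inter> insert (var_of ?q) X = {}"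
    using f unfolding Y_def by (auto dest: injD)
  ultimately obtain m where m: "m \<le> 3 + length Ds * (2 * card X + 4)" "regWRTI (extension ?q X F) m"
    using regWRTI_extension[OF Ds(1,3) X(4) q] by blast
  have "length Ds * (2 * card X + 4) \<le> n * (2 * n + 4)"
    using Ds(2) X(5) by (intro mult_le_mono) auto
  then have "m \<le> 3 + n * (2 * n + 4)" using m(1) by linarith
  moreover have "F \<noteq> {}" using Ds derivation_empty by fastforce
  then have "restrict_cnf [f 0 \<mapsto> True] (extension ?q X F) = Rest F"
    using assms(2) f(2) unfolding Y_def by (intro restrict_extension) auto
  then have "cnf_of (restrict_cnf [f 0 \<mapsto> True] (extension ?q X F)) = F" by simp
  moreover have "cnf (extension ?q X F)" using cnf_extension assms(1) X(4) by blast
  ultimately show ?thesis using m(2) by blast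
qed

section \<open>Equivalence and p-naturality\<close>

lemma poly_nat_mono: "m \<le> n \<Longrightarrow> poly p m \<le> poly p n" for p :: "nat poly"
  by (induction p) (auto intro: add_mono mult_le_mono)

text \<open>The refutation is translated to RD, restricted there without growth, and translated
  back; the two polynomial bounds compose.\<close>

lemma p_natural_if_equivalent_RD:
  assumes "equivalent R RD"
  shows "p_natural R"
proof -
  obtain p where p: "\<And>F n. cnf F \<Longrightarrow> RD F n \<Longrightarrow> \<exists>m \<le> poly p n. R F m"
    using assms unfolding equivalent_def simulates_def by blast
  obtain q where q: "\<And>F n. cnf F \<Longrightarrow> R F n \<Longrightarrow> \<exists>m \<le> poly q n. RD F m"
    using assms unfolding equivalent_def simulates_def by blast
  have "\<exists>m \<le> poly (pcompose p q) s. R (cnf_of (restrict_cnf \<alpha> F)) m" if F: "cnf F" "R F s" for F s \<alpha>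
  proof -
    obtain k where k: "k \<le> poly q s" "RD F k" using q[OF F] by blast
    obtain j where j: "j \<le> k" "RD (cnf_of (restrict_cnf \<alpha> F)) j"
      using RD_restrict[OF k(2)] by blast
    obtain m where "m \<le> poly p j" "R (cnf_of (restrict_cnf \<alpha> F)) m"
      using p[OF cnf_restrict[OF F(1)] j(2)] by blast
    moreover have "poly p j \<le> poly p (poly q s)" using j(1) k(1) by (intro poly_nat_mono) simp
    ultimately show ?thesis unfolding poly_pcompose by (meson order_trans)
  qed
  then show ?thesis unfolding p_natural_def by blast
qed

text \<open>Stated for any system lying between regWRTI and regWRTL, so that one argument serves
  both equivalences.\<close>

lemma equivalent_RD_if_p_natural:
  fixes R :: "'v::infinite refutation_system"
  assumes "p_natural R"
    and R: "\<And>F n. regWRTI F n \<Longrightarrow> R F n" "\<And>F n. R F n \<Longrightarrow> regWRTL F n"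
  shows "equivalent R RD"
proof -
  obtain p where p: "\<And>F s \<alpha>. cnf F \<Longrightarrow> R F s \<Longrightarrow> \<exists>m \<le> poly p s. R (cnf_of (restrict_cnf \<alpha> F)) m"
    using assms(1) unfolding p_natural_def by blast
  \<comment> \<open>The inner polynomial is \<open>3 + n * (2 * n + 4)\<close> expanded, the size
    bound for the extended formula. The summand 1 covers the case \<open>{} \<in> F\<close>, where a
    single leaf is a refutation.\<close>
  define q :: "nat poly" where "q = 1 + pcompose p [:3, 4, 2:]"
  have q: "poly q n = 1 + poly p (3 + n * (2 * n + 4))" for n
    by (simp add: q_def poly_pcompose algebra_simps)
  have "\<exists>m \<le> poly q n. R F m" if F: "cnf F" "RD F n" for F n
  proof (cases "{} \<in> F")
    case True
    then have "regWRTI_refutation F (Leaf {})"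
      by (simp add: regWRTI_refutation_iff input_lemmas_def regular_def)
    then have "regWRTI F 1" unfolding regWRTI_def by (force simp: tree_size_def)
    then show ?thesis using R(1) q by (metis le_add1)
  next
    case False
    obtain G \<alpha> k where G: "k \<le> 3 + n * (2 * n + 4)" "cnf G" "cnf_of (restrict_cnf \<alpha> G) = F"
      "regWRTI G k"
      using regWRTI_of_RD_extension[OF F(1) False F(2)] by blast
    then obtain m where "m \<le> poly p k" "R F m" using p[OF G(2) R(1)[OF G(4)]] by metis
    moreover have "poly p k \<le> poly q n" using poly_nat_mono[OF G(1), of p] q[of n] by linarith
    ultimately show ?thesis by (meson order_trans)
  qed
  then have "simulates R RD" unfolding simulates_def by blast
  moreover have "simulates RD R"
    \<comment> \<open>\<open>[:0, 1:]\<close> is the identity polynomial: the RD refutation is no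
      larger than the tree.\<close>
    unfolding simulates_def using RD_of_regWRTL[OF R(2)] by (intro exI[of _ "[:0, 1:]"]) simp
  ultimately show ?thesis unfolding equivalent_def by blast
qed

theorem theorem7p7:
  shows "(equivalent (regWRTI :: 'v::infinite refutation_system) RD
            \<longleftrightarrow> p_natural (regWRTI :: 'v refutation_system)) \<and>
         (equivalent (regWRTL :: 'v refutation_system) RD
            \<longleftrightarrow> p_natural (regWRTL :: 'v refutation_system))"
  using p_natural_if_equivalent_RD
    equivalent_RD_if_p_natural[of regWRTI] equivalent_RD_if_p_natural[of regWRTL]
    regWRTL_of_regWRTI
  by blast

end
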